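(* Let $m,n\in\mathbb N$, $m\ge n$, let $t_n\le t_{n+1}\le\dots\le t_{m+1}$, $\mu=\{\langle t_n\rangle^{n+1},\{t_i\}_{i=n+1,\dots,m},\langle t_{m+1}\rangle^{n+1}\}$, $\mathbf z_0,\dots,\mathbf z_m\in\mathbb C$, and let $\mathbf z(t)=\sum_{i=0}^m\mathbf z_iN^n_{i,\mu}(t)$, $t\in[t_n,t_{m+1}]$. Let $q=2n+(n+1)(m-n)$, $\nu=\{s_i\}_{i=0,\dots,4n+1+(n+1)(m-n)}=\{\langle t_n\rangle^{2n+1},\{\langle t_i\rangle^{n+1}\}_{i=n+1,\dots,m},\langle t_{m+1}\rangle^{2n+1}\}$, and let $\mathbf r(t)=\int\mathbf z^2(t)\,dt$, $t\in[t_n,t_{m+1}]$, be the corresponding clamped Pythagorean-Hodograph B-spline curve. Let $\sigma_k=\sum_{i=0}^m\sum_{j=0}^m\chi^{i,j}_k\mathbf z_i\bar{\mathbf z}_j$, $k=0,\dots,q$, be the coefficients of its parametric speed $\sigma(t)=|\mathbf r'(t)|=\mathbf z(t)\bar{\mathbf z}(t)=\sum_{k=0}^q\sigma_kN^{2n}_{k,\nu}(t)$, and let $l_0=0$, $l_{i+1}=l_i+\frac{s_{i+2n+1}-s_i}{2n+1}\sigma_i$ for $i=0,\dots,q$. Then the total arc length of $\mathbf r$ is $$L=\int_{t_n}^{t_{m+1}}\sigma(t)\,dt=l_{2n+1+(n+1)(m-n)}.$$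
   Context: Normalized B-splines: for a nondecreasing knot sequence $\mu=\{t_i\}$, $N^0_{i,\mu}(t)=1$ if $t\in[t_i,t_{i+1})$ and $0$ otherwise, and $N^n_{i,\mu}(t)=\frac{t-t_i}{t_{i+n}-t_i}N^{n-1}_{i,\mu}(t)+\frac{t_{i+n+1}-t}{t_{i+n+1}-t_{i+1}}N^{n-1}_{i+1,\mu}(t)$ with $0/0=0$. Basis functions and knots $s_i$ of $\nu$ are indexed starting at $0$. $\langle t\rangle^k$ denotes the knot $t$ repeated $k$ times. Points of $\mathbb R^2$ are identified with complex numbers. The coefficients $\chi^{i,j}_k$ ($0\le i,j\le m$, $0\le k\le q$) are those of the product expansion $N^n_{i,\mu}(t)N^n_{j,\mu}(t)=\sum_{k=0}^q\chi^{i,j}_kN^{2n}_{k,\nu}(t)$, obtained as the solution of the linear system $A\chi^{i,j}=b^{i,j}$ with $a_{k,l}=\int_{t_n}^{t_{m+1}}N^{2n}_{k,\nu}N^{2n}_{l,\nu}\,dt$ and $b^{i,j}_l=\int_{t_n}^{t_{m+1}}N^n_{i,\mu}N^n_{j,\mu}N^{2n}_{l,\nu}\,dt$. *)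

theory Defs
  imports "HOL-Analysis.Analysis"
begin

(* The convention 0/0 = 0 of the recursion is the library's x / 0 = 0: whenever a denominator
   vanishes, the B-spline of lower degree that it accompanies is identically 0. *)
fun bspline :: "real list \<Rightarrow> nat \<Rightarrow> nat \<Rightarrow> real \<Rightarrow> real" where
  "bspline u 0 i x = (if u ! i \<le> x \<and> x < u ! Suc i then 1 else 0)"
| "bspline u (Suc d) i x =
     (x - u ! i) / (u ! (i + Suc d) - u ! i) * bspline u d i x
     + (u ! (i + Suc d + 1) - x) / (u ! (i + Suc d + 1) - u ! (i + 1)) * bspline u d (i + 1) x"

definition preimage_knots :: "(nat \<Rightarrow> real) \<Rightarrow> nat \<Rightarrow> nat \<Rightarrow> real list" where
  "preimage_knots t n m =
     replicate (n + 1) (t n) @ map t [n + 1..<m + 1] @ replicate (n + 1) (t (m + 1))"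

definition speed_knots :: "(nat \<Rightarrow> real) \<Rightarrow> nat \<Rightarrow> nat \<Rightarrow> real list" where
  "speed_knots t n m =
     replicate (2 * n + 1) (t n)
     @ concat (map (\<lambda>i. replicate (n + 1) (t i)) [n + 1..<m + 1])
     @ replicate (2 * n + 1) (t (m + 1))"

lemma length_preimage_knots: "n \<le> m \<Longrightarrow> length (preimage_knots t n m) = m + n + 2"
  by (simp add: preimage_knots_def)

lemma length_speed_knots: "length (speed_knots t n m) = 4 * n + 2 + (n + 1) * (m - n)"
proof -
  have "length (concat (map (\<lambda>i. replicate (n + 1) (t i)) is)) = (n + 1) * length is" for "is"
    by (induction "is") auto
  from this[of "[n + 1..<m + 1]"]
  have "length (concat (map (\<lambda>i. replicate (n + 1) (t i)) [n + 1..<m + 1])) = (n + 1) * (m - n)"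
    by (simp only: length_upt add_diff_cancel_right)
  then show ?thesis
    unfolding speed_knots_def length_append length_replicate length_upt by linarith
qed

definition speed_matrix :: "(nat \<Rightarrow> real) \<Rightarrow> nat \<Rightarrow> nat \<Rightarrow> nat \<Rightarrow> nat \<Rightarrow> real" where
  "speed_matrix t n m k l = integral {t n..t (m + 1)}
     (\<lambda>x. bspline (speed_knots t n m) (2 * n) k x * bspline (speed_knots t n m) (2 * n) l x)"

definition product_rhs :: "(nat \<Rightarrow> real) \<Rightarrow> nat \<Rightarrow> nat \<Rightarrow> nat \<Rightarrow> nat \<Rightarrow> nat \<Rightarrow> real" where
  "product_rhs t n m i j l = integral {t n..t (m + 1)}
     (\<lambda>x. bspline (preimage_knots t n m) n i x * bspline (preimage_knots t n m) n j x
          * bspline (speed_knots t n m) (2 * n) l x)"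

(* The matrix is singular when an interior knot is repeated so often that some B-spline of
   degree 2n vanishes identically, so a solution is a relation and not a function of t, n, m. *)
definition is_product_coeffs ::
    "(nat \<Rightarrow> real) \<Rightarrow> nat \<Rightarrow> nat \<Rightarrow> (nat \<Rightarrow> nat \<Rightarrow> nat \<Rightarrow> real) \<Rightarrow> bool" where
  "is_product_coeffs t n m coef \<longleftrightarrow>
     (\<forall>i\<le>m. \<forall>j\<le>m. \<forall>k\<le>2 * n + (n + 1) * (m - n).
        (\<Sum>l\<le>2 * n + (n + 1) * (m - n). speed_matrix t n m k l * coef i j l)
          = product_rhs t n m i j k)"

(* For r the indefinite integral of z^2, the derivative of r can fail to exist at an interior knot
   of high multiplicity, and at the right end it is the left limit of z^2, not the value 0 given
   by the half-open convention; the integral ignores these finitely many points. *)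
definition arc_length :: "(real \<Rightarrow> complex) \<Rightarrow> real \<Rightarrow> real \<Rightarrow> real" where
  "arc_length r a b =
     integral {a..b} (\<lambda>x. norm (vector_derivative r (at x within {a..b})))"

lemma borel_measurable_bspline: "bspline u d i \<in> borel_measurable borel"
proof (induction d arbitrary: i)
  case 0
  have "bspline u 0 i = indicator {u ! i..<u ! Suc i}"
    by (auto simp: indicator_def)
  then show ?case by simp
next
  case (Suc d)
  note Suc[of i, measurable] Suc[of "i + 1", measurable]
  show ?case by (subst bspline.simps[abs_def]) measurable
qed

lemma bspline_bounded: "\<exists>B. \<forall>x\<in>{a..b}. \<bar>bspline u d i x\<bar> \<le> B"
proof (induction d arbitrary: i)
  case 0
  show ?case by (rule exI[of _ 1]) auto
next
  case (Suc d)
  have lin: "\<exists>B. \<forall>x\<in>{a..b}. \<bar>(p * x + c) / e\<bar> \<le> B" for p c e :: real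
  proof -
    have "compact ((\<lambda>x. (p * x + c) * inverse e) ` {a..b})"
      by (intro compact_continuous_image compact_Icc continuous_intros)
    then have "bounded ((\<lambda>x. (p * x + c) * inverse e) ` {a..b})"
      by (rule compact_imp_bounded)
    then show ?thesis
      unfolding bounded_iff divide_inverse by (simp only: ball_simps image_iff real_norm_def)
  qed
  have mult: "\<exists>B. \<forall>x\<in>{a..b}. \<bar>f x * g x\<bar> \<le> B"
    if fg: "\<exists>B. \<forall>x\<in>{a..b}. \<bar>f x\<bar> \<le> B" "\<exists>B. \<forall>x\<in>{a..b}. \<bar>g x\<bar> \<le> B" for f g :: "real \<Rightarrow> real"
  proof -
    obtain B C where BC: "\<And>x. x \<in> {a..b} \<Longrightarrow> \<bar>f x\<bar> \<le> B" "\<And>x. x \<in> {a..b} \<Longrightarrow> \<bar>g x\<bar> \<le> C"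
      using fg by blast
    have "\<bar>f x * g x\<bar> \<le> B * C" if "x \<in> {a..b}" for x
      unfolding abs_mult by (rule mult_mono) (use BC[OF that] in linarith)+
    then show ?thesis by blast
  qed
  have "\<exists>B. \<forall>x\<in>{a..b}. \<bar>(1 * x + - u ! i) / (u ! (i + Suc d) - u ! i) * bspline u d i x\<bar> \<le> B"
    by (intro mult lin Suc)
  moreover have "\<exists>B. \<forall>x\<in>{a..b}. \<bar>(- 1 * x + u ! (i + Suc d + 1))
      / (u ! (i + Suc d + 1) - u ! (i + 1)) * bspline u d (i + 1) x\<bar> \<le> B"
    by (intro mult lin Suc)
  ultimately obtain B C where B: "\<forall>x\<in>{a..b}. \<bar>(1 * x + - u ! i) / (u ! (i + Suc d) - u ! i) * bspline u d i x\<bar> \<le> B"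
    and C: "\<forall>x\<in>{a..b}. \<bar>(- 1 * x + u ! (i + Suc d + 1))
      / (u ! (i + Suc d + 1) - u ! (i + 1)) * bspline u d (i + 1) x\<bar> \<le> C" by blast
  have "\<bar>bspline u (Suc d) i x\<bar> \<le> B + C" if "x \<in> {a..b}" for x
    using order_trans[OF abs_triangle_ineq add_mono[OF B[rule_format, OF that] C[rule_format, OF that]]]
    by simp
  then show ?case by blast
qed

lemma integrable_bspline_mult:
  "(\<lambda>x. bspline u d i x * bspline v e j x) integrable_on {a..b}"
proof -
  obtain B C where BC: "\<And>x. x \<in> {a..b} \<Longrightarrow> \<bar>bspline u d i x\<bar> \<le> B"
    "\<And>x. x \<in> {a..b} \<Longrightarrow> \<bar>bspline v e j x\<bar> \<le> C"
    using bspline_bounded[of a b u d i] bspline_bounded[of a b v e j] by blast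
  note [measurable] = borel_measurable_bspline
  show ?thesis
  proof (rule measurable_bounded_by_integrable_imp_integrable_real[where g = "\<lambda>_. B * C"])
    show "(\<lambda>x. bspline u d i x * bspline v e j x) \<in> borel_measurable (lebesgue_on {a..b})"
      by (intro measurable_restrict_space1 measurable_completion) measurable
    show "\<bar>bspline u d i x * bspline v e j x\<bar> \<le> B * C" if "x \<in> {a..b}" for x
      unfolding abs_mult by (rule mult_mono) (use BC[OF that] in linarith)+
  qed auto
qed

lemma is_product_coeffs_if_expansion:
  assumes "\<And>i j x. i \<le> m \<Longrightarrow> j \<le> m \<Longrightarrow> x \<in> {t n..t (m + 1)} \<Longrightarrow>
      bspline (preimage_knots t n m) n i x * bspline (preimage_knots t n m) n j x
        = (\<Sum>k\<le>2 * n + (n + 1) * (m - n). coef i j k * bspline (speed_knots t n m) (2 * n) k x)"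
  shows "is_product_coeffs t n m coef"
  unfolding is_product_coeffs_def
proof (intro allI impI)
  fix i j k assume ij: "i \<le> m" "j \<le> m"
  let ?N = "bspline (speed_knots t n m) (2 * n)"
  let ?Q = "{..2 * n + (n + 1) * (m - n)}"
  have "product_rhs t n m i j k = integral {t n..t (m + 1)} (\<lambda>x. \<Sum>l\<in>?Q. ?N k x * ?N l x * coef i j l)"
    unfolding product_rhs_def
    by (rule integral_cong) (simp add: assms[OF ij] sum_distrib_left sum_distrib_right mult_ac)
  also have "\<dots> = (\<Sum>l\<in>?Q. integral {t n..t (m + 1)} (\<lambda>x. ?N k x * ?N l x * coef i j l))"
    by (intro integral_sum integrable_on_mult_left integrable_bspline_mult) simp
  also have "\<dots> = (\<Sum>l\<in>?Q. speed_matrix t n m k l * coef i j l)"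
    by (simp add: speed_matrix_def)
  finally show "(\<Sum>l\<in>?Q. speed_matrix t n m k l * coef i j l) = product_rhs t n m i j k" ..
qed

end

theory Submission
  imports Defs
begin

text \<open>
  The product expansion itself is not needed. The B-splines of degree \<open>2n\<close> sum to 1, so summing
  the normal equations over all rows shows that any solution \<open>coef i j\<close> satisfies
  \<open>(\<Sum>k. coef i j k * \<integral>N\<^sub>k) = \<integral>N\<^sub>i N\<^sub>j\<close>, even when the matrix is singular.
  It remains to know \<open>\<integral>N\<^sub>k\<close>. To cover knots of arbitrary multiplicity, where the derivative formula
  for B-splines breaks down, all moments are computed at once by induction on the degree:
  \<open>\<integral>x\<^sup>p N\<^sub>k\<close> is a multiple of the complete homogeneous symmetric polynomial of degree \<open>p\<close>
  in the knots that support \<open>N\<^sub>k\<close>.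
\<close>

section \<open>Complete homogeneous symmetric polynomials\<close>

text \<open>The variables are \<open>u i, \<dots>, u (i + d)\<close>, and \<open>p\<close> is the degree of the polynomial.\<close>

fun complete_hom :: "(nat \<Rightarrow> 'a::comm_ring_1) \<Rightarrow> nat \<Rightarrow> nat \<Rightarrow> nat \<Rightarrow> 'a" where
  "complete_hom u i 0 p = u i ^ p"
| "complete_hom u i (Suc d) 0 = 1"
| "complete_hom u i (Suc d) (Suc p) =
     complete_hom u i d (Suc p) + u (i + Suc d) * complete_hom u i (Suc d) p"

lemma complete_hom_0 [simp]: "complete_hom u i d 0 = 1"
  by (cases d) auto

text \<open>The definition splits off the last variable; by symmetry of the polynomial the first one
  can be split off as well. Symmetry is not visible from the recursion, so both recursions are
  matched by a double induction on \<open>d\<close> and \<open>p\<close>.\<close>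

lemma complete_hom_Suc_left:
  "complete_hom u i (Suc d) (Suc p) =
     complete_hom u (Suc i) d (Suc p) + u i * complete_hom u i (Suc d) p"
proof (induction d arbitrary: p)
  case 0
  show ?case
  proof (induction p)
    case (Suc p)
    have "complete_hom u i (Suc 0) (Suc (Suc p)) =
        u i ^ Suc (Suc p) + u (Suc i) * (u (Suc i) ^ Suc p + u i * complete_hom u i (Suc 0) p)"
      using Suc by simp
    then show ?case by (simp add: algebra_simps)
  qed (simp add: algebra_simps)
next
  case (Suc d)
  note outer = Suc
  show ?case
  proof (induction p)
    case 0
    then show ?case using outer[of 0] by (simp add: algebra_simps)
  next
    case (Suc p)
    have "complete_hom u i (Suc (Suc d)) (Suc (Suc p)) =
        (complete_hom u (Suc i) d (Suc (Suc p)) + u i * complete_hom u i (Suc d) (Suc p))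
        + u (i + Suc (Suc d)) * (complete_hom u (Suc i) (Suc d) (Suc p) + u i * complete_hom u i (Suc (Suc d)) p)"
      using outer[of "Suc p"] Suc complete_hom.simps(3)[of u i "Suc d" "Suc p"] by simp
    also have "\<dots> = complete_hom u (Suc i) (Suc d) (Suc (Suc p)) + u i * complete_hom u i (Suc (Suc d)) (Suc p)"
      by (simp add: algebra_simps)
    finally show ?case .
  qed
qed

text \<open>Subtracting the recursions at the two end variables gives the recursion of divided
  differences: \<open>complete_hom u i d p\<close> is the divided difference of the power
  \<open>p + d\<close> at \<open>u i\<close>, ..., \<open>u (i + d)\<close>.\<close>

lemma complete_hom_divided_difference:
  "(u (i + Suc d) - u i) * complete_hom u i (Suc d) p =
     complete_hom u (Suc i) d (Suc p) - complete_hom u i d (Suc p)"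
  using complete_hom_Suc_left[of u i d p] complete_hom.simps(3)[of u i d p]
  by (simp add: algebra_simps)

text \<open>The binomial coefficient counts the monomials of degree \<open>p\<close> in
  \<open>d + 1\<close> variables.\<close>

lemma complete_hom_const:
  assumes "\<And>j. i \<le> j \<Longrightarrow> j \<le> i + d \<Longrightarrow> u j = a"
  shows "complete_hom u i d p = of_nat (p + d choose d) * a ^ p"
  using assms
proof (induction u i d p rule: complete_hom.induct)
  case (3 u i d p)
  from 3 show ?case by (simp add: algebra_simps)
qed auto

text \<open>The ratio of consecutive binomial coefficients in \<open>complete_hom_const\<close>. It
  supplies the vanishing needed below when a denominator of the B-spline recursion is 0.\<close>

lemma complete_hom_const_Suc:
  fixes a :: "'a::comm_ring_1"
  assumes "\<And>j. i \<le> j \<Longrightarrow> j \<le> i + d \<Longrightarrow> u j = a"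
  shows "of_nat (Suc p) * complete_hom u i d (Suc p)
    = of_nat (Suc (p + d)) * (a * complete_hom u i d p)"
proof -
  have "Suc p * (Suc p + d choose d) = Suc (p + d) * (p + d choose d)"
    using Suc_times_binomial[of p "p + d"] binomial_symmetric[of d "p + d"] binomial_symmetric[of d "Suc p + d"]
    by (simp del: binomial_Suc_Suc)
  then have *: "of_nat (Suc p) * of_nat (Suc p + d choose d)
      = (of_nat (Suc (p + d)) * of_nat (p + d choose d) :: 'a)"
    by (metis of_nat_mult)
  have "of_nat (Suc p) * complete_hom u i d (Suc p)
      = of_nat (Suc p) * of_nat (Suc p + d choose d) * (a * a ^ p)"
    by (simp only: complete_hom_const[OF assms] power_Suc mult.assoc)
  also have "\<dots> = of_nat (Suc (p + d)) * (a * complete_hom u i d p)"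
    by (simp only: * complete_hom_const[OF assms] mult_ac)
  finally show ?thesis .
qed

text \<open>This identity merges the two halves of the B-spline recursion into a single moment. For
  \<open>p = Suc r\<close>, all terms are expressed through the polynomials of degrees
  \<open>p\<close> and \<open>r\<close> in the full set of variables; those of degree
  \<open>r\<close> cancel.\<close>

lemma complete_hom_weighted_difference:
  "of_nat (Suc p) * (complete_hom u i d (Suc p) - complete_hom u (Suc i) d (Suc p))
     + of_nat (p + d + 1) * (u (i + Suc d) * complete_hom u (Suc i) d p - u i * complete_hom u i d p)
   = of_nat d * (u (i + Suc d) - u i) * complete_hom u i (Suc d) p"
proof (cases p)
  case 0
  then show ?thesis
    using complete_hom_divided_difference[of u i d 0] by (simp add: algebra_simps)
next
  case (Suc r)
  let ?h = "complete_hom u" and ?e = "u (i + Suc d)"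
  have l: "?h (Suc i) d p = ?h i (Suc d) p - u i * ?h i (Suc d) r"
    unfolding Suc complete_hom_Suc_left[of u i d r] by simp
  have r: "?h i d p = ?h i (Suc d) p - ?e * ?h i (Suc d) r"
    unfolding Suc complete_hom.simps by simp
  have d: "?h i d (Suc p) - ?h (Suc i) d (Suc p) = - ((?e - u i) * ?h i (Suc d) p)"
    using complete_hom_divided_difference[of u i d p] by simp
  show ?thesis
    unfolding l r d by (simp add: algebra_simps)
qed

section \<open>Support and moments of B-splines\<close>

text \<open>If the two end knots coincide, the alternatives cover every \<open>x\<close>, so the
  spline is identically 0; this justifies the convention 0/0 = 0.\<close>

lemma bspline_eq_0:
  assumes "sorted u" "i + d + 1 < length u" "x < u ! i \<or> u ! (i + d + 1) \<le> x"
  shows "bspline u d i x = 0"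
  using assms(2,3)
proof (induction d arbitrary: i)
  case 0
  then show ?case by auto
next
  case (Suc d)
  have "u ! i \<le> u ! Suc i" "u ! Suc (i + d) \<le> u ! Suc (Suc (i + d))"
    using Suc.prems(1) assms(1) by (auto intro!: sorted_nth_mono)
  then have "bspline u d i x = 0" "bspline u d (i + 1) x = 0"
    using Suc.prems by (auto intro!: Suc.IH)
  then show ?case by simp
qed

text \<open>The recursion multiplies splines of degree \<open>d\<close> by linear factors, so moment
  \<open>p\<close> in degree \<open>Suc d\<close> uses moments \<open>p\<close> and
  \<open>p + 1\<close> in degree \<open>d\<close>; hence the induction keeps \<open>p\<close>
  arbitrary. The quotient of factorials is the Beta value B(p+1, d+1).\<close>

lemma has_integral_power_mult_bspline:
  assumes "sorted u" "i + d + 1 < length u" "a \<le> u ! i" "u ! (i + d + 1) \<le> b"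
  shows "((\<lambda>x. x ^ p * bspline u d i x) has_integral
    fact p * fact d / fact (p + d + 1) * (u ! (i + d + 1) - u ! i) * complete_hom ((!) u) i (d + 1) p) {a..b}"
  using assms(2-4)
proof (induction d arbitrary: i p)
  case 0
  have le: "u ! i \<le> u ! Suc i"
    using 0 assms(1) by (auto intro!: sorted_nth_mono)
  have "((\<lambda>x. x ^ p) has_integral
      (u ! Suc i ^ Suc p / Suc p - u ! i ^ Suc p / Suc p)) {u ! i..u ! Suc i}"
    by (intro fundamental_theorem_of_calculus le, unfold has_real_derivative_iff_has_vector_derivative[symmetric])
       (rule derivative_eq_intros refl | simp del: of_nat_Suc)+
  also have "u ! Suc i ^ Suc p / Suc p - u ! i ^ Suc p / Suc p
      = fact p * fact 0 / fact (p + 0 + 1) * (u ! (i + 0 + 1) - u ! i) * complete_hom ((!) u) i (0 + 1) p"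
  proof -
    have "fact p * fact 0 / fact (p + 0 + 1) = (1 / Suc p :: real)"
      by simp
    then show ?thesis
      using complete_hom_divided_difference[of "(!) u" i 0 p]
      by (simp add: diff_divide_distrib[symmetric] del: of_nat_Suc fact_Suc)
  qed
  finally have "((\<lambda>x. if x \<in> {u ! i..u ! Suc i} then x ^ p else 0) has_integral
      fact p * fact 0 / fact (p + 0 + 1) * (u ! (i + 0 + 1) - u ! i) * complete_hom ((!) u) i (0 + 1) p) {a..b}"
    using 0 by (subst has_integral_restrict) auto
  \<comment> \<open>The closed knot span and the half-open support differ only at the right
    knot.\<close>
  then show ?case
    by (rule has_integral_spike_finite[where S = "{u ! Suc i}", rotated -1]) auto
next
  case (Suc d)
  let ?h = "complete_hom ((!) u)" and ?e = "i + Suc d"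
  define C :: real where "C = fact p * fact d / fact (p + d + 1)"
  define I where "I p i = fact p * fact d / fact (p + d + 1) * (u ! (i + d + 1) - u ! i) * ?h i (d + 1) p" for p i
  have mono: "u ! j \<le> u ! k" if "j \<le> k" "k \<le> i + d + 2" for j k
    using that Suc.prems assms(1) by (auto intro!: sorted_nth_mono)
  have I: "((\<lambda>x. x ^ p * bspline u d j x) has_integral I p j) {a..b}" if "j \<in> {i, i + 1}" for p j
    unfolding I_def by (rule Suc.IH) (use Suc.prems mono[of i "i+1"] mono[of "i + d + 1" "i + d + 2"] that in auto)
  have C_Suc: "fact (Suc p) * fact d / fact (Suc p + d + 1) = C * (p + 1) / (p + d + 2)"
    unfolding C_def by (simp add: field_simps)
  \<comment> \<open>For equal knots the left-hand side is 0 by \<open>x / 0 = 0\<close>, and the right-hand side happens to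
    vanish too, so that repeated knots need no separate treatment afterwards.\<close>
  have quotient: "(I (p + 1) j - w * I p j) / (u ! (j + d + 1) - u ! j)
      = C * ((p + 1) * ?h j (d + 1) (p + 1) / (p + d + 2) - w * ?h j (d + 1) p)"
    if "j \<in> {i, i + 1}" "w = u ! j \<or> w = u ! (j + d + 1)" for j w
  proof (cases "u ! (j + d + 1) = u ! j")
    case True
    have "u ! k = w" if "j \<le> k" "k \<le> j + (d + 1)" for k
      using mono[of j k] mono[of k "j + d + 1"] that \<open>j \<in> _\<close> \<open>w = _ \<or> _\<close> True by auto
    then have "(p + 1) * ?h j (d + 1) (p + 1) = (p + d + 2) * (w * ?h j (d + 1) p)"
      using complete_hom_const_Suc[of j "d + 1" "(!) u" w p] by simp
    then have "(p + 1) * ?h j (d + 1) (p + 1) / (p + d + 2) = w * ?h j (d + 1) p"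
      by (simp add: field_simps)
    with True show ?thesis by simp
  next
    case False
    have "I (p + 1) j - w * I p j = (u ! (j + d + 1) - u ! j)
        * (C * ((p + 1) * ?h j (d + 1) (p + 1) / (p + d + 2) - w * ?h j (d + 1) p))"
      using C_Suc unfolding I_def C_def[symmetric] by (simp add: algebra_simps)
    with False show ?thesis by simp
  qed
  \<comment> \<open>The sign of the falling factor is flipped, so that both halves have the form (x
    - w) treated by \<open>quotient\<close>, with w the left end knot in the first half and the
    right end knot in the second.\<close>
  have "((\<lambda>x. (x ^ (p + 1) * bspline u d i x - u ! i * (x ^ p * bspline u d i x)) / (u ! ?e - u ! i)
        - (x ^ (p + 1) * bspline u d (i + 1) x - u ! (?e + 1) * (x ^ p * bspline u d (i + 1) x))
            / (u ! (?e + 1) - u ! (i + 1)))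
      has_integral ((I (p + 1) i - u ! i * I p i) / (u ! ?e - u ! i)
        - (I (p + 1) (i + 1) - u ! (?e + 1) * I p (i + 1)) / (u ! (?e + 1) - u ! (i + 1)))) {a..b}"
    by (intro has_integral_diff has_integral_divide has_integral_mult_right I) auto
  also have "(\<lambda>x. (x ^ (p + 1) * bspline u d i x - u ! i * (x ^ p * bspline u d i x)) / (u ! ?e - u ! i)
        - (x ^ (p + 1) * bspline u d (i + 1) x - u ! (?e + 1) * (x ^ p * bspline u d (i + 1) x))
            / (u ! (?e + 1) - u ! (i + 1)))
      = (\<lambda>x. x ^ p * bspline u (Suc d) i x)"
    by (rule ext) (simp add: diff_divide_distrib ring_distribs mult_ac)
  also have "(I (p + 1) i - u ! i * I p i) / (u ! ?e - u ! i)
        - (I (p + 1) (i + 1) - u ! (?e + 1) * I p (i + 1)) / (u ! (?e + 1) - u ! (i + 1))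
      = C / (p + d + 2) * (Suc p * (?h i (d + 1) (Suc p) - ?h (Suc i) (d + 1) (Suc p))
          + (p + (d + 1) + 1) * (u ! (i + Suc (d + 1)) * ?h (Suc i) (d + 1) p - u ! i * ?h i (d + 1) p))"
    using quotient[of i "u ! i"] quotient[of "i + 1" "u ! (?e + 1)"]
    by (simp add: field_simps)
  also have "\<dots> = C / (p + d + 2) * ((d + 1) * (u ! (i + Suc (d + 1)) - u ! i) * ?h i (Suc (d + 1)) p)"
    using complete_hom_weighted_difference[of p "(!) u" i "d + 1"] by (metis of_nat_Suc Suc_eq_plus1)
  also have "\<dots> = fact p * fact (Suc d) / fact (p + Suc d + 1) * (u ! (i + Suc d + 1) - u ! i) * ?h i (Suc d + 1) p"
    unfolding C_def by (simp add: field_simps)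
  finally show ?case .
qed

lemma has_integral_bspline:
  assumes "sorted u" "i + d + 1 < length u" "a \<le> u ! i" "u ! (i + d + 1) \<le> b"
  shows "(bspline u d i has_integral (u ! (i + d + 1) - u ! i) / (d + 1)) {a..b}"
proof -
  have "fact 0 * fact d / fact (0 + d + 1) = (1 / (d + 1) :: real)"
    by simp
  then show ?thesis
    using has_integral_power_mult_bspline[OF assms, of 0] by (simp del: fact_Suc)
qed

section \<open>Partition of unity and continuity\<close>

text \<open>Each spline of lower degree enters twice, with a rising weight \<open>A\<close> and a
  falling weight \<open>B\<close> that together restore it. The first and the last one vanish at
  \<open>x\<close>, so shifting the index loses nothing.\<close>

lemma sum_bspline_eq_1:
  assumes "sorted u" "q + d + 1 < length u" "u ! d \<le> x" "x < u ! (q + 1)"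
  shows "(\<Sum>k\<le>q. bspline u d k x) = 1"
  using assms(2-4)
proof (induction d)
  case 0
  then show ?case
  proof (induction q)
    case 0
    then show ?case by simp
  next
    case (Suc q)
    show ?case
    proof (cases "x < u ! Suc q")
      case True
      then show ?thesis using Suc by simp
    next
      case False
      have "u ! Suc k \<le> x" if "k \<le> q" for k
        using sorted_nth_mono[OF assms(1), of "Suc k" "Suc q"] that Suc.prems False by simp
      then have "(\<Sum>k\<le>q. bspline u 0 k x) = 0"
        by (intro sum.neutral) (auto simp: not_less)
      then show ?thesis using Suc False by simp
    qed
  qed
next
  case (Suc d)
  let ?N = "bspline u d"
  define A B where "A k = (x - u ! k) / (u ! (k + Suc d) - u ! k) * ?N k x"
    and "B k = (u ! (k + Suc d) - x) / (u ! (k + Suc d) - u ! k) * ?N k x" for k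
  have AB: "A k + B k = ?N k x" if "k \<le> q + 1" for k
  proof (cases "u ! (k + Suc d) = u ! k")
    case True
    then have "?N k x = 0"
      using that Suc.prems by (intro bspline_eq_0[OF assms(1)]) auto
    then show ?thesis by (simp add: A_def B_def)
  next
    case False
    then show ?thesis
      unfolding A_def B_def distrib_right[symmetric] add_divide_distrib[symmetric] by simp
  qed
  have N: "?N 0 x = 0" "?N (q + 1) x = 0"
    using Suc.prems by (auto intro!: bspline_eq_0[OF assms(1)])
  have "u ! d \<le> u ! Suc d"
    using Suc.prems by (auto intro!: sorted_nth_mono assms(1))
  then have IH: "(\<Sum>k\<le>q. ?N k x) = 1"
    using Suc by auto
  have "(\<Sum>k\<le>q. bspline u (Suc d) k x) = (\<Sum>k\<le>q. A k) + (\<Sum>k\<le>q. B (Suc k))"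
    by (simp add: A_def B_def sum.distrib)
  also have "\<dots> = (\<Sum>k\<le>q. A k) + (\<Sum>k\<le>Suc q. B k)"
    unfolding sum.atMost_Suc_shift using N by (simp add: B_def)
  also have "\<dots> = (\<Sum>k\<le>q. A k + B k)"
    using N by (simp add: B_def sum.distrib)
  also have "\<dots> = (\<Sum>k\<le>q. ?N k x)"
    by (intro sum.cong refl AB) auto
  finally show ?case using IH by simp
qed

text \<open>Away from the knots the splines of degree 0 are locally constant, and the recursion
  preserves continuity whatever the multiplicities.\<close>

lemma isCont_bspline:
  assumes "i + d + 1 < length u" "x \<notin> set u"
  shows "isCont (bspline u d i) x"
  using assms(1)
proof (induction d arbitrary: i)
  case 0
  have "u ! i \<noteq> x" "u ! Suc i \<noteq> x"
    using 0 assms(2) by auto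
  then consider "x \<in> {u ! i <..< u ! Suc i}" | "x \<in> - {u ! i .. u ! Suc i}"
    by fastforce
  then show ?case
  proof cases
    case 1
    have "\<forall>\<^sub>F y in nhds x. bspline u 0 i y = 1"
      using eventually_nhds_in_open[OF open_greaterThanLessThan 1] by (rule eventually_mono) auto
    then show ?thesis by (simp add: isCont_cong)
  next
    case 2
    have "\<forall>\<^sub>F y in nhds x. bspline u 0 i y = 0"
      using eventually_nhds_in_open[OF open_Compl[OF closed_atLeastAtMost] 2] by (rule eventually_mono) auto
    then show ?thesis by (simp add: isCont_cong)
  qed
next
  case (Suc d)
  have "isCont (bspline u d i) x" "isCont (bspline u d (i + 1)) x"
    using Suc.prems by (auto intro!: Suc.IH)
  then show ?case
    unfolding bspline.simps[abs_def] divide_inverse by (intro continuous_intros)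
qed

section \<open>The knot sequence of the parametric speed\<close>

lemma sorted_concat_map_replicate:
  "sorted (map f xs) \<Longrightarrow> sorted (concat (map (\<lambda>i. replicate k (f i)) xs))"
  by (induction xs) (auto simp: sorted_append)

lemma sorted_map_interior_knots:
  "mono_on {n..m + 1} t \<Longrightarrow> sorted (map t [n + 1..<m + 1])"
  unfolding sorted_map
  by (rule sorted_wrt_mono_rel[OF _ sorted_upt]) (auto intro!: mono_onD[of "{n..m + 1}" t])

lemma sorted_speed_knots:
  assumes "n \<le> m" "mono_on {n..m + 1} t"
  shows "sorted (speed_knots t n m)"
  unfolding speed_knots_def sorted_append
  using assms sorted_concat_map_replicate[OF sorted_map_interior_knots[OF assms(2)], of "n + 1"]
  by (auto intro!: mono_onD[OF assms(2)])

lemma nth_speed_knots_first: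
  "k \<le> 2 * n \<Longrightarrow> speed_knots t n m ! k = t n"
  unfolding speed_knots_def nth_append length_replicate by (simp del: replicate_Suc)

lemma nth_speed_knots_last:
  assumes "n \<le> m" "2 * n + (n + 1) * (m - n) < k" "k < length (speed_knots t n m)"
  shows "speed_knots t n m ! k = t (m + 1)"
proof -
  define xs where "xs = replicate (2 * n + 1) (t n)
     @ concat (map (\<lambda>i. replicate (n + 1) (t i)) [n + 1..<m + 1])"
  have eq: "speed_knots t n m = xs @ replicate (2 * n + 1) (t (m + 1))"
    by (simp only: xs_def speed_knots_def append_assoc)
  have "length xs = 2 * n + 1 + (n + 1) * (m - n)"
    using length_speed_knots[of t n m] unfolding eq length_append length_replicate by simp
  then show ?thesis
    using assms length_speed_knots[of t n m] unfolding eq nth_append by (simp del: replicate_Suc)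
qed

section \<open>Integrals of products from the normal equations\<close>

text \<open>The equations make the residual of the expansion orthogonal to every B-spline of degree
  \<open>2 * n\<close>, hence to their sum 1, so its integral is 0.\<close>

lemma product_coeffs_integral:
  assumes "n \<le> m" "mono_on {n..m + 1} t" "is_product_coeffs t n m coef" "i \<le> m" "j \<le> m"
  defines "\<nu> \<equiv> speed_knots t n m" and "q \<equiv> 2 * n + (n + 1) * (m - n)"
  shows "integral {t n..t (m + 1)}
      (\<lambda>x. bspline (preimage_knots t n m) n i x * bspline (preimage_knots t n m) n j x)
    = (\<Sum>k\<le>q. coef i j k * ((\<nu> ! (k + 2 * n + 1) - \<nu> ! k) / (2 * n + 1)))"
proof -
  let ?I = "{t n..t (m + 1)}" and ?N = "bspline \<nu> (2 * n)" and ?M = "bspline (preimage_knots t n m) n"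
  have sorted: "sorted \<nu>"
    unfolding \<nu>_def by (rule sorted_speed_knots[OF assms(1,2)])
  have len: "length \<nu> = q + 2 * n + 2"
    unfolding \<nu>_def length_speed_knots q_def by simp
  have first: "\<nu> ! (2 * n) = t n" "\<nu> ! 0 = t n"
    unfolding \<nu>_def by (auto simp: nth_speed_knots_first)
  have last: "\<nu> ! (q + 1) = t (m + 1)" "\<nu> ! (q + 2 * n + 1) = t (m + 1)"
    using len unfolding \<nu>_def q_def by (intro nth_speed_knots_last assms(1); simp)+
  \<comment> \<open>At the right end all these splines are 0 by the half-open convention; the
    integrals below ignore that point.\<close>
  have pou: "(\<Sum>k\<le>q. ?N k x) = 1" if "x \<in> ?I - {t (m + 1)}" for x
    by (rule sum_bspline_eq_1[OF sorted]) (use that len first last in auto)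
  have int_N: "(?N k has_integral (\<nu> ! (k + 2 * n + 1) - \<nu> ! k) / (2 * n + 1)) ?I" if "k \<le> q" for k
  proof -
    have "\<nu> ! 0 \<le> \<nu> ! k" "\<nu> ! (k + 2 * n + 1) \<le> \<nu> ! (q + 2 * n + 1)"
      using that len by (auto intro!: sorted_nth_mono sorted)
    then show ?thesis
      using has_integral_bspline[OF sorted, of k "2 * n" "t n" "t (m + 1)"] that len first last by simp
  qed
  have int_NN: "(\<lambda>x. ?N k x * ?N l x) integrable_on ?I" for k l
    by (rule integrable_bspline_mult)
  have int_MMN: "(\<lambda>x. ?M i x * ?M j x * ?N k x) integrable_on ?I" for k
  proof -
    obtain B1 B2 B3 where B: "\<And>x. x \<in> ?I \<Longrightarrow> \<bar>?M i x\<bar> \<le> B1" "\<And>x. x \<in> ?I \<Longrightarrow> \<bar>?M j x\<bar> \<le> B2"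
      "\<And>x. x \<in> ?I \<Longrightarrow> \<bar>?N k x\<bar> \<le> B3"
      using bspline_bounded[of "t n" "t (m + 1)"] by meson
    note [measurable] = borel_measurable_bspline
    show ?thesis
    proof (rule measurable_bounded_by_integrable_imp_integrable_real[where g = "\<lambda>_. B1 * B2 * B3"])
      show "(\<lambda>x. ?M i x * ?M j x * ?N k x) \<in> borel_measurable (lebesgue_on ?I)"
        by (intro measurable_restrict_space1 measurable_completion) measurable
      show "\<bar>?M i x * ?M j x * ?N k x\<bar> \<le> B1 * B2 * B3" if "x \<in> ?I" for x
        unfolding abs_mult using B[OF that]
        by (intro mult_mono mult_nonneg_nonneg) (auto intro: order_trans[OF abs_ge_zero])
    qed auto
  qed
  have "integral ?I (\<lambda>x. ?M i x * ?M j x) = integral ?I (\<lambda>x. \<Sum>k\<le>q. ?M i x * ?M j x * ?N k x)"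
    by (rule integral_spike[of "{t (m + 1)}"]) (auto simp: pou sum_distrib_left[symmetric])
  also have "\<dots> = (\<Sum>k\<le>q. product_rhs t n m i j k)"
    unfolding product_rhs_def \<nu>_def[symmetric] by (intro integral_sum int_MMN finite_atMost)
  also have "\<dots> = (\<Sum>k\<le>q. \<Sum>l\<le>q. speed_matrix t n m k l * coef i j l)"
    using assms(3-5) unfolding is_product_coeffs_def q_def by auto
  \<comment> \<open>Only column sums of the matrix remain, and each is the integral of one spline
    times the partition of unity.\<close>
  also have "\<dots> = (\<Sum>l\<le>q. coef i j l * (\<Sum>k\<le>q. speed_matrix t n m k l))"
    by (subst sum.swap) (simp add: sum_distrib_left mult.commute)
  also have "\<dots> = (\<Sum>l\<le>q. coef i j l * ((\<nu> ! (l + 2 * n + 1) - \<nu> ! l) / (2 * n + 1)))"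
  proof (intro sum.cong refl arg_cong2[where f = "(*)"])
    fix l assume "l \<in> {..q}"
    have "(\<Sum>k\<le>q. speed_matrix t n m k l) = integral ?I (\<lambda>x. \<Sum>k\<le>q. ?N k x * ?N l x)"
      unfolding speed_matrix_def \<nu>_def[symmetric] by (intro integral_sum[symmetric] int_NN finite_atMost)
    also have "\<dots> = integral ?I (?N l)"
      by (rule integral_spike[of "{t (m + 1)}"]) (auto simp: pou sum_distrib_right[symmetric])
    also have "\<dots> = (\<nu> ! (l + 2 * n + 1) - \<nu> ! l) / (2 * n + 1)"
      using \<open>l \<in> {..q}\<close> by (intro integral_unique int_N) auto
    finally show "(\<Sum>k\<le>q. speed_matrix t n m k l) = (\<nu> ! (l + 2 * n + 1) - \<nu> ! l) / (2 * n + 1)" .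
  qed
  finally show ?thesis .
qed

section \<open>Arc length of the curve\<close>

text \<open>With two coefficient families, one statement serves both \<open>z x * cnj (z x)\<close>
  and the square of \<open>z x\<close>.\<close>

lemma has_integral_sum_bspline_mult:
  fixes f g :: "nat \<Rightarrow> complex"
  shows "((\<lambda>x. (\<Sum>i\<le>m. f i * of_real (bspline u n i x)) * (\<Sum>j\<le>m. g j * of_real (bspline u n j x)))
    has_integral (\<Sum>i\<le>m. \<Sum>j\<le>m. f i * g j *
      of_real (integral {a..b} (\<lambda>x. bspline u n i x * bspline u n j x)))) {a..b}"
proof -
  have "((\<lambda>x. \<Sum>i\<le>m. \<Sum>j\<le>m. f i * g j * of_real (bspline u n i x * bspline u n j x))
    has_integral (\<Sum>i\<le>m. \<Sum>j\<le>m. f i * g j *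
      of_real (integral {a..b} (\<lambda>x. bspline u n i x * bspline u n j x)))) {a..b}"
    by (intro has_integral_sum has_integral_mult_right has_integral_of_real integrable_integral
        integrable_bspline_mult finite_atMost)
  then show ?thesis
    by (simp add: sum_product mult_ac)
qed

theorem mainTheorem5:
  fixes m n q :: nat and t :: "nat \<Rightarrow> real"
    and zc :: "nat \<Rightarrow> complex" and z r :: "real \<Rightarrow> complex" and c :: complex
    and coef :: "nat \<Rightarrow> nat \<Rightarrow> nat \<Rightarrow> real" and \<sigma> l :: "nat \<Rightarrow> complex"
    and \<mu> \<nu> :: "real list"
  assumes "n \<le> m"
    and "mono_on {n..m + 1} t"
    and "\<mu> = preimage_knots t n m"
    and "\<nu> = speed_knots t n m"
    and "q = 2 * n + (n + 1) * (m - n)"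
    and "\<And>x. x \<in> {t n..t (m + 1)} \<Longrightarrow> z x = (\<Sum>i\<le>m. zc i * of_real (bspline \<mu> n i x))"
    and "\<And>x. x \<in> {t n..t (m + 1)} \<Longrightarrow> r x = c + integral {t n..x} (\<lambda>y. (z y)\<^sup>2)"
    and "is_product_coeffs t n m coef"
    and "\<And>k. k \<le> q \<Longrightarrow> \<sigma> k = (\<Sum>i\<le>m. \<Sum>j\<le>m. of_real (coef i j k) * zc i * cnj (zc j))"
    and "l 0 = 0"
    and "\<And>i. i \<le> q \<Longrightarrow> l (i + 1) = l i + of_real ((\<nu> ! (i + 2 * n + 1) - \<nu> ! i) / (2 * n + 1)) * \<sigma> i"
  shows "of_real (arc_length r (t n) (t (m + 1))) = integral {t n..t (m + 1)} (\<lambda>x. z x * cnj (z x))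
       \<and> integral {t n..t (m + 1)} (\<lambda>x. z x * cnj (z x)) = l (2 * n + 1 + (n + 1) * (m - n))"
proof -
  let ?I = "{t n..t (m + 1)}"
  \<comment> \<open>The hypotheses fix \<open>z\<close> on \<open>?I\<close> only; \<open>w\<close>
    is the same sum on the whole line, so two-sided continuity can be read off from the
    splines.\<close>
  define w where "w x = (\<Sum>i\<le>m. zc i * of_real (bspline \<mu> n i x))" for x
  have zw: "z x = w x" if "x \<in> ?I" for x
    using assms(6)[OF that] by (simp add: w_def)
  have tle: "t n \<le> t (m + 1)"
    using assms(1) by (intro mono_onD[OF assms(2)]) auto
  have cnj_w: "cnj (w x) = (\<Sum>i\<le>m. cnj (zc i) * of_real (bspline \<mu> n i x))" for x
    by (simp add: w_def)
  define J where "J = (\<Sum>i\<le>m. \<Sum>j\<le>m. zc i * cnj (zc j) *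
      of_real (integral ?I (\<lambda>x. bspline \<mu> n i x * bspline \<mu> n j x)))"
  have J: "((\<lambda>x. z x * cnj (z x)) has_integral J) ?I"
    unfolding J_def
    by (subst has_integral_cong[OF arg_cong2[where f = "(*)", OF zw arg_cong[where f = cnj, OF zw]]])
       (unfold cnj_w, auto simp only: w_def intro: has_integral_sum_bspline_mult)
  have "l (k + 1) = (\<Sum>i\<le>k. of_real ((\<nu> ! (i + 2 * n + 1) - \<nu> ! i) / (2 * n + 1)) * \<sigma> i)" if "k \<le> q" for k
    using that
  proof (induction k)
    case 0
    then show ?case using assms(10) assms(11)[of 0] by simp
  next
    case (Suc k)
    then show ?case using assms(11)[of "Suc k"] by simp
  qed
  then have "l (q + 1) = (\<Sum>k\<le>q. of_real ((\<nu> ! (k + 2 * n + 1) - \<nu> ! k) / (2 * n + 1))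
      * (\<Sum>i\<le>m. \<Sum>j\<le>m. of_real (coef i j k) * zc i * cnj (zc j)))"
    using assms(9) by simp
  also have "\<dots> = (\<Sum>k\<le>q. \<Sum>i\<le>m. \<Sum>j\<le>m. zc i * cnj (zc j)
      * of_real (coef i j k * ((\<nu> ! (k + 2 * n + 1) - \<nu> ! k) / (2 * n + 1))))"
    unfolding sum_distrib_left of_real_mult by (intro sum.cong refl) (simp only: mult_ac)
  also have "\<dots> = (\<Sum>i\<le>m. \<Sum>j\<le>m. \<Sum>k\<le>q. zc i * cnj (zc j)
      * of_real (coef i j k * ((\<nu> ! (k + 2 * n + 1) - \<nu> ! k) / (2 * n + 1))))"
    by (subst sum.swap) (intro sum.cong refl sum.swap)
  also have "\<dots> = J"
    unfolding J_def assms(3)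
    by (intro sum.cong refl, subst product_coeffs_integral[OF assms(1,2,8)])
       (simp_all only: atMost_iff of_real_sum sum_distrib_left assms(4,5))
  finally have l: "l (q + 1) = J" .

  have sq_int: "(\<lambda>x. (w x)\<^sup>2) integrable_on ?I"
    unfolding power2_eq_square w_def by (intro has_integral_integrable[OF has_integral_sum_bspline_mult])
  \<comment> \<open>\<open>\<mu>\<close> contains both end points, so \<open>x\<close> is interior
    and not a knot. A nondegenerate interval makes the derivative within \<open>?I\<close>
    unique.\<close>
  have speed: "norm (vector_derivative r (at x within ?I)) = Re (z x * cnj (z x))"
    if x: "x \<in> ?I - set \<mu>" and less: "t n < t (m + 1)" for x
  proof -
    have "isCont (bspline \<mu> n i) x" if "i \<le> m" for i
      using x that length_preimage_knots[OF assms(1), of t] assms(3) by (intro isCont_bspline) auto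
    then have "isCont w x"
      unfolding w_def by (intro continuous_intros) auto
    then have "isCont (\<lambda>x. (w x)\<^sup>2) x"
      by (rule isCont_power)
    \<comment> \<open>The fundamental theorem allows a finite exceptional set; it is taken empty to
      obtain the derivative within all of \<open>?I\<close>.\<close>
    then have "continuous (at x within ?I - {}) (\<lambda>x. (w x)\<^sup>2)"
      by (rule continuous_at_imp_continuous_within)
    then have "((\<lambda>u. integral {t n..u} (\<lambda>x. (w x)\<^sup>2)) has_vector_derivative (w x)\<^sup>2) (at x within ?I - {})"
      using x by (intro integral_has_vector_derivative_continuous_at sq_int) auto
    then have "((\<lambda>u. c + integral {t n..u} (\<lambda>x. (w x)\<^sup>2)) has_vector_derivative 0 + (w x)\<^sup>2) (at x within ?I)"
      by (intro has_vector_derivative_add has_vector_derivative_const) simp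
    moreover have "r u = c + integral {t n..u} (\<lambda>x. (w x)\<^sup>2)" if "u \<in> ?I" for u
      unfolding assms(7)[OF that] using that by (intro arg_cong2[where f = "(+)"] refl integral_cong) (simp add: zw)
    ultimately have "(r has_vector_derivative (w x)\<^sup>2) (at x within ?I)"
      using x by (auto intro: has_vector_derivative_transform)
    then have "vector_derivative r (at x within ?I) = (w x)\<^sup>2"
      using x less by (intro vector_derivative_within_closed_interval) auto
    \<comment> \<open>The Pythagorean-hodograph property: the modulus of a square is the number
      times its conjugate.\<close>
    then show ?thesis
      using x zw[of x] by (simp add: norm_power complex_mult_cnj cmod_power2)
  qed
  have ReJ: "((\<lambda>x. Re (z x * cnj (z x))) has_integral Re J) ?I"
    using has_integral_linear[OF J bounded_linear_Re] by (simp add: o_def)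
  have "arc_length r (t n) (t (m + 1)) = Re J"
  proof (cases "t n < t (m + 1)")
    case True
    have "((\<lambda>x. norm (vector_derivative r (at x within ?I))) has_integral Re J) ?I"
      using has_integral_spike_finite[OF finite_set[of \<mu>] speed[OF _ True] ReJ] by simp
    then show ?thesis unfolding arc_length_def by (rule integral_unique)
  next
    case False
    \<comment> \<open>On a one-point interval both integrals are 0, whatever value the derivative
      takes.\<close>
    with tle have "t (m + 1) = t n" by simp
    then show ?thesis using integral_unique[OF ReJ] by (simp add: arc_length_def)
  qed
  \<comment> \<open>The arc length determines only \<open>Re J\<close>; the claim is an equation
    between complex numbers.\<close>
  moreover have "Im J = 0"
  proof -
    have "((\<lambda>x. Im (z x * cnj (z x))) has_integral Im J) ?I"
      using has_integral_linear[OF J bounded_linear_Im] by (simp add: o_def)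
    then have "((\<lambda>x. 0::real) has_integral Im J) ?I"
      by (simp add: mult.commute)
    then show ?thesis by (simp add: has_integral_0_eq)
  qed
  moreover have "integral ?I (\<lambda>x. z x * cnj (z x)) = J"
    using J by (rule integral_unique)
  moreover have "2 * n + 1 + (n + 1) * (m - n) = q + 1"
    using assms(5) by simp
  ultimately show ?thesis
    using l by (simp add: complex_eq_iff)
qed

end
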